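(* The following identity of power series in $q$ holds: $$G_2(q)=G_8(q)+20\,G_8(q)^2+128\,G_8(q)^3+256\,G_8(q)^4.$$
   Context: $G_2(q)=q\prod_{n\ge1}\left(\frac{1-q^{2n}}{1-q^n}\right)^{24}$ and $G_8(q)=q\prod_{n\ge1}\frac{(1-q^{8n})^4(1-q^{2n})^2}{(1-q^{4n})^2(1-q^n)^4}$; equivalently, with $q=e^{2\pi i\tau}$, $\operatorname{Im}\tau>0$, and $\eta(\tau)=e^{\pi i\tau/12}\prod_{n\ge1}(1-e^{2\pi i n\tau})$ the Dedekind eta function, $G_2(q)=\left(\eta(2\tau)/\eta(\tau)\right)^{24}$ and $G_8(q)=\frac{\eta^4(8\tau)\eta^2(2\tau)}{\eta^2(4\tau)\eta^4(\tau)}$. *)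

theory Defs
  imports "HOL-Analysis.Analysis" "HOL-Computational_Algebra.Computational_Algebra"
begin

text \<open>
  The variable \<open>q\<close> is \<^const>\<open>fps_X\<close>. The infinite products are taken with respect to the
  \<open>X\<close>-adic topology on formal power series, and the index is shifted so that
  \<open>n \<ge> 1\<close> becomes \<open>Suc n\<close>. All denominators are units, having constant coefficient 1.
\<close>

definition G2 :: "complex fps" where
  "G2 = fps_X * (\<Prod>n. ((1 - fps_X ^ (2 * Suc n)) / (1 - fps_X ^ Suc n)) ^ 24)"

definition G8 :: "complex fps" where
  "G8 = fps_X * (\<Prod>n. ((1 - fps_X ^ (8 * Suc n)) ^ 4 * (1 - fps_X ^ (2 * Suc n)) ^ 2) /
                       ((1 - fps_X ^ (4 * Suc n)) ^ 2 * (1 - fps_X ^ Suc n) ^ 4))"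

end

theory Submission
  imports Defs
begin

text \<open>
  Write \<open>E(q)\<close> for Euler's product of the factors \<open>1 - q\<^sup>n\<close>, \<open>n \<ge> 1\<close>. Gauss's theta series
  \<open>\<phi>(q)\<close>, the sum of \<open>q ^ (k\<^sup>2)\<close> over all integers \<open>k\<close>, and \<open>\<psi>(q)\<close>, the sum of
  \<open>q ^ (k (k + 1) / 2)\<close> over \<open>k \<ge> 0\<close>, are the products \<open>\<phi>(q) = E(- q)\<^sup>2 / E(q\<^sup>2)\<close> and
  \<open>\<psi>(q) = E(q\<^sup>2)\<^sup>2 / E(q)\<close>. In these terms \<open>G8 = X \<psi>(X\<^sup>4)\<^sup>2 / \<phi>(- X)\<^sup>2\<close>.

  The quartic polynomial factors as \<open>g (1 + 4 g) (1 + 8 g)\<^sup>2\<close>. The identity holds because, for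
  \<open>g = G8\<close>, each factor is a quotient of theta functions: \<open>1 + 4 g = \<phi>(X\<^sup>2)\<^sup>2 / \<phi>(- X)\<^sup>2\<close> and
  \<open>1 + 8 g = \<phi>(X)\<^sup>2 / \<phi>(- X)\<^sup>2\<close>. Once this is known, both sides are eta quotients and can be
  compared factor by factor.

  Splitting the sum for \<open>\<phi>\<close> into even and odd \<open>k\<close> gives \<open>\<phi>(X) = a + b\<close> with \<open>a = \<phi>(X\<^sup>4)\<close> and
  \<open>b = 2 X \<psi>(X\<^sup>8)\<close> (\<open>theta_dissection\<close>). Replacing \<open>X\<close> by \<open>- X\<close> and \<open>\<plusminus> i X\<close> leaves \<open>a\<close> fixed
  and multiplies \<open>b\<close> by \<open>- 1\<close> and \<open>\<plusminus> i\<close>. The product rule \<open>\<phi>(q) \<phi>(- q) = \<phi>(- q\<^sup>2)\<^sup>2\<close>, a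
  consequence of \<open>euler_prod_uminus_mult\<close>, then yields \<open>\<phi>(- X\<^sup>2)\<^sup>2 = a\<^sup>2 - b\<^sup>2\<close> at \<open>q = X\<close> and
  \<open>\<phi>(X\<^sup>2)\<^sup>2 = a\<^sup>2 + b\<^sup>2\<close> at \<open>q = i X\<close>. As the products also give \<open>a b = 2 X \<psi>(X\<^sup>4)\<^sup>2\<close>, it follows that
  \<open>g = a b / (2 (a - b)\<^sup>2)\<close>, and the two formulas above are the identities
  \<open>(a - b)\<^sup>2 + 2 a b = a\<^sup>2 + b\<^sup>2\<close> and \<open>(a - b)\<^sup>2 + 4 a b = (a + b)\<^sup>2\<close>.

  The product formulas for \<open>\<phi>\<close> and \<open>\<psi>\<close> are special cases of Jacobi's triple product. They are
  obtained as limits of the finite \<open>q\<close>-binomial theorem (\<open>qbinomial_theorem\<close>,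
  \<open>qbinom_sum_diff_tendsto_0\<close>), where the limit is taken coefficientwise.
\<close>

section \<open>The X-adic topology and divisibility by powers of X\<close>

lemma fps_X_power_dvd_iff:
  fixes f :: "'a::comm_ring_1 fps"
  shows "fps_X ^ n dvd f \<longleftrightarrow> (\<forall>i<n. fps_nth f i = 0)"
proof
  assume "\<forall>i<n. fps_nth f i = 0"
  hence "f = fps_X ^ n * fps_shift n f"
    by (auto simp: fps_eq_iff fps_X_power_mult_nth)
  thus "fps_X ^ n dvd f" by (metis dvd_triv_left)
qed (auto simp: fps_X_power_mult_nth elim!: dvdE)

text \<open>
  Convergence of power series, phrased through divisibility: limit arguments below become
  congruences modulo \<open>X\<^sup>n\<close>, which are stable under ring operations.
\<close>
lemma tendsto_fps_iff_dvd:
  fixes g :: "'a::comm_ring_1 fps"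
  shows "(f \<longlongrightarrow> g) F \<longleftrightarrow> (\<forall>n. \<forall>\<^sub>F x in F. fps_X ^ n dvd f x - g)"
proof
  assume *: "(f \<longlongrightarrow> g) F"
  show "\<forall>n. \<forall>\<^sub>F x in F. fps_X ^ n dvd f x - g"
  proof
    fix n
    have "\<forall>\<^sub>F x in F. \<forall>i\<in>{..<n}. fps_nth (f x) i = fps_nth g i"
      using * by (subst eventually_ball_finite_distrib) (auto simp: tendsto_fps_iff)
    thus "\<forall>\<^sub>F x in F. fps_X ^ n dvd f x - g"
      by eventually_elim (auto simp: fps_X_power_dvd_iff)
  qed
next
  assume *: "\<forall>n. \<forall>\<^sub>F x in F. fps_X ^ n dvd f x - g"
  show "(f \<longlongrightarrow> g) F"
  proof (rule tendsto_fpsI)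
    fix n
    have "\<forall>\<^sub>F x in F. fps_X ^ Suc n dvd f x - g" using * by blast
    thus "\<forall>\<^sub>F x in F. fps_nth (f x) n = fps_nth g n"
      by eventually_elim (simp only: fps_X_power_dvd_iff, simp)
  qed
qed

lemma tendsto_fst_snd_prod_nhds:
  fixes a :: "'a::topological_space" and b :: "'b::topological_space"
  shows "(fst \<longlongrightarrow> a) (nhds a \<times>\<^sub>F nhds b)" "(snd \<longlongrightarrow> b) (nhds a \<times>\<^sub>F nhds b)"
  by (auto simp: filterlim_def filtermap_fst_prod_filter filtermap_snd_prod_filter)

text \<open>
  The ideals generated by the powers of \<open>X\<close> form a basis of neighbourhoods of \<open>0\<close>, so the
  ring operations are continuous and the general limit rules apply to power series.
\<close>
instance fps :: (comm_ring_1) topological_group_add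
proof
  fix a b :: "'a fps"
  have "\<forall>\<^sub>F x in nhds a \<times>\<^sub>F nhds b. fps_X ^ n dvd (fst x + snd x) - (a + b)" for n
  proof -
    have "\<forall>\<^sub>F x in nhds a \<times>\<^sub>F nhds b. fps_X ^ n dvd fst x - a"
      "\<forall>\<^sub>F x in nhds a \<times>\<^sub>F nhds b. fps_X ^ n dvd snd x - b"
      using tendsto_fst_snd_prod_nhds[where a = a and b = b] by (simp_all only: tendsto_fps_iff_dvd)
    thus ?thesis
    proof eventually_elim
      case (elim x)
      have "(fst x + snd x) - (a + b) = (fst x - a) + (snd x - b)"
        by (simp add: algebra_simps)
      with elim show ?case by (metis dvd_add)
    qed
  qed
  thus "((\<lambda>x. fst x + snd x) \<longlongrightarrow> a + b) (nhds a \<times>\<^sub>F nhds b)"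
    by (simp add: tendsto_fps_iff_dvd)
next
  fix a :: "'a fps"
  have "\<forall>\<^sub>F x in nhds a. fps_X ^ n dvd - x - - a" for n
  proof -
    have "\<forall>\<^sub>F x in nhds a. fps_X ^ n dvd x - a"
      using filterlim_ident[of "nhds a"] by (simp only: tendsto_fps_iff_dvd)
    thus ?thesis
    proof eventually_elim
      case (elim x)
      have "- x - - a = - (x - a)" by simp
      with elim show ?case by (metis dvd_minus_iff)
    qed
  qed
  thus "(uminus \<longlongrightarrow> - a) (nhds a)"
    unfolding tendsto_fps_iff_dvd by blast
qed

instance fps :: (comm_ring_1) topological_semigroup_mult
proof
  fix a b :: "'a fps"
  have "\<forall>\<^sub>F x in nhds a \<times>\<^sub>F nhds b. fps_X ^ n dvd (fst x * snd x) - (a * b)" for n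
  proof -
    have "\<forall>\<^sub>F x in nhds a \<times>\<^sub>F nhds b. fps_X ^ n dvd fst x - a"
      "\<forall>\<^sub>F x in nhds a \<times>\<^sub>F nhds b. fps_X ^ n dvd snd x - b"
      using tendsto_fst_snd_prod_nhds[where a = a and b = b] by (simp_all only: tendsto_fps_iff_dvd)
    thus ?thesis
    proof eventually_elim
      case (elim x)
      have "(fst x * snd x) - (a * b) = (fst x - a) * snd x + a * (snd x - b)"
        by (simp add: algebra_simps)
      with elim show ?case by (metis dvd_add dvd_mult dvd_mult2)
    qed
  qed
  thus "((\<lambda>x. fst x * snd x) \<longlongrightarrow> a * b) (nhds a \<times>\<^sub>F nhds b)"
    by (simp add: tendsto_fps_iff_dvd)
qed

lemma prodinf_eqI:
  fixes f :: "nat \<Rightarrow> 'a::{semidom,t2_space}"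
  assumes "(\<lambda>N. \<Prod>n<N. f n) \<longlonglongrightarrow> P" "P \<noteq> 0"
  shows "prodinf f = P"
proof -
  have "(\<lambda>N. \<Prod>n\<le>N. f n) \<longlonglongrightarrow> P"
    using LIMSEQ_Suc[OF assms(1)] by (simp add: lessThan_Suc_atMost)
  hence "f has_prod P" using assms(2) by (simp add: has_prod_def raw_has_prod_def)
  thus ?thesis by (metis has_prod_unique)
qed

section \<open>Euler's product\<close>

definition euler_prod :: "complex fps \<Rightarrow> complex fps" where
  "euler_prod q = (\<Prod>n. 1 - q ^ Suc n)"

definition qpoch :: "'a::comm_ring_1 \<Rightarrow> nat \<Rightarrow> 'a" where
  "qpoch q N = (\<Prod>n<N. 1 - q ^ Suc n)"

lemma qpoch_nth_0 [simp]: "fps_nth q 0 = 0 \<Longrightarrow> fps_nth (qpoch q N) 0 = (1 :: 'a :: comm_ring_1)"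
  by (induction N) (simp_all add: qpoch_def fps_power_zeroth)

text \<open>
  The factor with index \<open>n\<close> is \<open>1\<close> modulo \<open>X\<^sup>n\<^sup>+\<^sup>1\<close> because \<open>q\<close> has no constant term. So the
  partial products converge; the limit is nonzero because its constant coefficient is \<open>1\<close>,
  as the definition of an infinite product demands.
\<close>
lemma qpoch_tendsto_and_euler_prod_nth_0:
  assumes "fps_nth q 0 = 0" "q \<noteq> 0"
  shows "qpoch q \<longlonglongrightarrow> euler_prod q \<and> fps_nth (euler_prod q) 0 = 1"
proof -
  have sub: "subdegree q \<ge> 1"
    using assms by (metis One_nat_def Suc_leI not_gr_zero nth_subdegree_nonzero)
  have "\<exists>P. (\<lambda>N. \<Prod>n\<le>N. 1 - q ^ Suc n) \<longlonglongrightarrow> P"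
  proof (rule exI, rule tendsto_prod_fps[where g = "\<lambda>n. n"])
    fix k show "1 - q ^ Suc k \<noteq> 0"
    proof
      assume "1 - q ^ Suc k = 0"
      hence "fps_nth (1 - q ^ Suc k) 0 = 0" by simp
      thus False using assms by (simp add: fps_power_zeroth)
    qed
  next
    fix n k :: nat assume "k > n"
    have "subdegree (1 - q ^ Suc k - 1) = Suc k * subdegree q"
      proof -
      have "1 - q ^ Suc k - 1 = - (q ^ Suc k)" by (simp del: power_Suc)
      thus ?thesis by (simp only: subdegree_uminus subdegree_power)
    qed
    moreover have "Suc k * 1 \<le> Suc k * subdegree q" by (intro mult_le_mono sub) simp
    ultimately show "n < subdegree (1 - q ^ Suc k - 1)"
      using \<open>k > n\<close> by (metis Suc_lessD less_le_trans mult.right_neutral not_less_eq)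
  qed
  then obtain P where "(\<lambda>N. qpoch q (Suc N)) \<longlonglongrightarrow> P"
    by (auto simp: qpoch_def lessThan_Suc_atMost)
  hence P: "qpoch q \<longlonglongrightarrow> P" by (simp add: filterlim_sequentially_Suc)
  hence "\<forall>\<^sub>F N in sequentially. fps_nth (qpoch q N) 0 = fps_nth P 0" by (simp add: tendsto_fps_iff)
  hence P0: "fps_nth P 0 = 1" using assms by simp
  hence "P \<noteq> 0" by auto
  hence "euler_prod q = P"
    unfolding euler_prod_def using P by (intro prodinf_eqI) (simp_all add: qpoch_def[abs_def])
  with P P0 show ?thesis by simp
qed

lemmas qpoch_tendsto = qpoch_tendsto_and_euler_prod_nth_0[THEN conjunct1]
lemmas euler_prod_nth_0 = qpoch_tendsto_and_euler_prod_nth_0[THEN conjunct2]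

section \<open>The q-binomial theorem\<close>

text \<open>
  The Pascal rule, rather than the quotient of \<open>q\<close>-factorials, because it makes sense in every
  commutative ring; \<open>qbinom_mult_qpoch\<close> recovers the quotient form without a division.
\<close>
fun qbinom :: "'a::comm_ring_1 \<Rightarrow> nat \<Rightarrow> nat \<Rightarrow> 'a" where
  "qbinom p n 0 = 1"
| "qbinom p 0 (Suc k) = 0"
| "qbinom p (Suc n) (Suc k) = qbinom p n k + p ^ Suc k * qbinom p n (Suc k)"

lemma qbinom_eq_0: "n < k \<Longrightarrow> qbinom p n k = 0"
  by (induction p n k rule: qbinom.induct) auto

lemma qbinom_self [simp]: "qbinom p n n = 1"
  by (induction n) (simp_all add: qbinom_eq_0)

lemma qpoch_Suc: "qpoch p (Suc n) = qpoch p n * (1 - p ^ Suc n)"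
  by (simp add: qpoch_def)

lemma qpoch_0 [simp]: "qpoch p 0 = 1"
  by (simp add: qpoch_def)

lemma qbinom_mult_qpoch:
  "qbinom p (i + j) i * qpoch p i * qpoch p j = qpoch p (i + j)"
proof (induction "i + j" arbitrary: i j)
  case 0 thus ?case by simp
next
  case (Suc n)
  show ?case
  proof (cases i; cases j)
    fix a b assume ij: "i = Suc a" "j = Suc b"
    have 1: "qbinom p (a + j) a * qpoch p a * qpoch p j = qpoch p (a + j)"
      by (rule Suc.hyps(1)) (use Suc.hyps(2) ij in simp)
    have 2: "qbinom p (i + b) i * qpoch p i * qpoch p b = qpoch p (i + b)"
      by (rule Suc.hyps(1)) (use Suc.hyps(2) ij in simp)
    have n: "i + j = Suc (a + j)" "i + b = a + j" using ij by auto
    have "qbinom p (i + j) i * qpoch p i * qpoch p j =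
       (qbinom p (a + j) a + p ^ i * qbinom p (i + b) i) * qpoch p i * qpoch p j"
      unfolding n by (simp add: ij)
    also have "\<dots> = (qbinom p (a + j) a * qpoch p a * qpoch p j) * (1 - p ^ i)
        + p ^ i * (qbinom p (i + b) i * qpoch p i * qpoch p b) * (1 - p ^ j)"
      by (simp add: ij qpoch_Suc algebra_simps)
    also have "\<dots> = qpoch p (a + j) * (1 - p ^ (i + j))"
      unfolding 1 2 unfolding n(2) by (simp add: algebra_simps power_add)
    also have "\<dots> = qpoch p (i + j)" by (simp add: n(1) qpoch_Suc)
    finally show ?thesis .
  qed simp_all
qed

text \<open>
  The form with two free parameters \<open>x\<close> and \<open>y\<close> stands in for negative powers: a Jacobi type
  product, symmetric under \<open>z \<mapsto> 1/z\<close>, is obtained by taking \<open>y\<close> to be a high power of \<open>p\<close>.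
  Splitting off the first factor replaces \<open>x\<close> by \<open>x p\<close>, which matches the Pascal rule.
\<close>
lemma qbinomial_theorem:
  fixes x y p :: "'a::comm_ring_1"
  shows "(\<Prod>i<n. y + x * p ^ i) = (\<Sum>j\<le>n. qbinom p n j * p ^ (j choose 2) * x ^ j * y ^ (n - j))"
proof (induction n arbitrary: x)
  case 0 thus ?case by (simp add: numeral_2_eq_2)
next
  case (Suc n)
  let ?t = "\<lambda>x j. qbinom p n j * p ^ (j choose 2) * x ^ j * y ^ (n - j)"
  have ch: "Suc j choose 2 = j + (j choose 2)" for j by (simp add: numeral_2_eq_2)
  have "(\<Prod>i<Suc n. y + x * p ^ i) = (y + x) * (\<Prod>i<n. y + (x * p) * p ^ i)"
    by (subst prod.lessThan_Suc_shift) (simp add: mult.assoc)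
  also have "\<dots> = (\<Sum>j\<le>n. x * ?t (x * p) j) + (\<Sum>j\<le>n. y * ?t (x * p) j)"
    by (simp add: Suc.IH sum_distrib_left[symmetric] distrib_right)
  also have "(\<Sum>j\<le>n. x * ?t (x * p) j) =
     (\<Sum>j\<le>n. qbinom p n j * p ^ (Suc j choose 2) * x ^ Suc j * y ^ (Suc n - Suc j))"
    by (intro sum.cong) (simp_all add: ch power_add power_mult_distrib algebra_simps)
  also have "(\<Sum>j\<le>n. y * ?t (x * p) j) = (\<Sum>j\<le>Suc n. y * ?t (x * p) j)"
    by (simp add: qbinom_eq_0)
  also have "\<dots> = y * ?t (x * p) 0 + (\<Sum>j\<le>n. y * ?t (x * p) (Suc j))"
    by (subst sum.atMost_Suc_shift) simp
  also have "y * ?t (x * p) 0 = y ^ Suc n" by (simp add: numeral_2_eq_2)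
  also have "(\<Sum>j\<le>n. y * ?t (x * p) (Suc j)) = 
     (\<Sum>j\<le>n. p ^ Suc j * qbinom p n (Suc j) * p ^ (Suc j choose 2) * x ^ Suc j * y ^ (Suc n - Suc j))"
  proof (intro sum.cong refl)
    fix j assume "j \<in> {..n}"
    show "y * ?t (x * p) (Suc j) = p ^ Suc j * qbinom p n (Suc j) * p ^ (Suc j choose 2) * x ^ Suc j * y ^ (Suc n - Suc j)"
    proof (cases "j = n")
      case False
      with \<open>j \<in> {..n}\<close> have "n - j = Suc (n - Suc j)" by auto
      thus ?thesis by (simp add: power_mult_distrib algebra_simps)
    qed (simp add: qbinom_eq_0)
  qed
  also have "(\<Sum>j\<le>n. qbinom p n j * p ^ (Suc j choose 2) * x ^ Suc j * y ^ (Suc n - Suc j)) + (y ^ Suc n + \<dots>) = 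
     (\<Sum>j\<le>Suc n. qbinom p (Suc n) j * p ^ (j choose 2) * x ^ j * y ^ (Suc n - j))"
    by (subst sum.atMost_Suc_shift) (simp add: sum.distrib algebra_simps numeral_2_eq_2)
  finally show ?case .
qed

section \<open>Limits of sums of q-binomial coefficients\<close>

lemma fps_X_power_dvd_mult_unit_iff:
  fixes f u :: "'a::field fps"
  assumes "fps_nth u 0 \<noteq> 0"
  shows "fps_X ^ n dvd f * u \<longleftrightarrow> fps_X ^ n dvd f"
proof
  assume "fps_X ^ n dvd f * u"
  hence "fps_X ^ n dvd (f * u) * inverse u" by (rule dvd_mult2)
  also have "(f * u) * inverse u = f"
    using assms by (simp add: mult.assoc inverse_mult_eq_1')
  finally show "fps_X ^ n dvd f" .
qed (rule dvd_mult2)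

text \<open>
  The central \<open>q\<close>-binomial coefficients tend to \<open>1 / euler_prod p\<close>, uniformly as long as the
  index stays within a bounded distance of the middle. When the weights \<open>w N j\<close> vanish to high
  order away from \<open>j = N\<close>, the coefficients may therefore be replaced by this constant.
  This is the step from finite product identities to theta series.
\<close>
lemma qbinom_sum_diff_tendsto_0:
  fixes w :: "nat \<Rightarrow> nat \<Rightarrow> complex fps"
  assumes p: "fps_nth p 0 = 0" "p \<noteq> 0"
  assumes w: "\<And>N j K. N + K < j \<or> j + K \<le> N \<Longrightarrow> fps_X ^ K dvd w N j"
  shows "(\<lambda>N. euler_prod p * (\<Sum>j\<le>2 * N + c. qbinom p (2 * N + c) j * w N j)
              - (\<Sum>j\<le>2 * N + c. w N j)) \<longlonglongrightarrow> 0"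
  unfolding tendsto_fps_iff_dvd diff_0_right
proof
  fix K
  have "\<forall>\<^sub>F N in sequentially. fps_X ^ K dvd qpoch p N - euler_prod p"
    using qpoch_tendsto[OF p] by (simp only: tendsto_fps_iff_dvd)
  then obtain M where M: "fps_X ^ K dvd qpoch p N - euler_prod p" if "N \<ge> M" for N
    by (auto simp: eventually_sequentially)
  have qb: "fps_X ^ K dvd euler_prod p * qbinom p (i + j) i - 1" if ij: "i \<ge> M" "j \<ge> M" for i j
  proof -
    \<comment> \<open>After multiplication by the unit \<open>qpoch p i * qpoch p j\<close>, both terms are congruent to
      the square of \<open>euler_prod p\<close>.\<close>
    have "(euler_prod p * qbinom p (i + j) i - 1) * (qpoch p i * qpoch p j)
        = euler_prod p * (qbinom p (i + j) i * qpoch p i * qpoch p j) - qpoch p i * qpoch p j"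
      by (simp add: algebra_simps)
    also have "\<dots> = euler_prod p * (qpoch p (i + j) - euler_prod p)
        - euler_prod p * (qpoch p i - euler_prod p) - qpoch p i * (qpoch p j - euler_prod p)"
      unfolding qbinom_mult_qpoch by (simp add: algebra_simps)
    finally have "fps_X ^ K dvd (euler_prod p * qbinom p (i + j) i - 1) * (qpoch p i * qpoch p j)"
      using ij by (simp only:) (intro dvd_diff dvd_mult M; simp)
    thus ?thesis using p by (subst (asm) fps_X_power_dvd_mult_unit_iff) simp_all
  qed
  show "\<forall>\<^sub>F N in sequentially. fps_X ^ K dvd
      euler_prod p * (\<Sum>j\<le>2 * N + c. qbinom p (2 * N + c) j * w N j) - (\<Sum>j\<le>2 * N + c. w N j)"
    using eventually_ge_at_top[of "M + K"]
  proof eventually_elim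
    case (elim N)
    have "fps_X ^ K dvd (euler_prod p * qbinom p (2 * N + c) j - 1) * w N j"
      if j: "j \<le> 2 * N + c" for j
    proof (cases "N + K < j \<or> j + K \<le> N")
      case True
      thus ?thesis by (intro dvd_mult w)
    next
      case False
      hence "fps_X ^ K dvd euler_prod p * qbinom p (j + (2 * N + c - j)) j - 1"
        using elim by (intro qb) auto
      with j show ?thesis by (intro dvd_mult2) simp
    qed
    hence "fps_X ^ K dvd (\<Sum>j\<le>2 * N + c. (euler_prod p * qbinom p (2 * N + c) j - 1) * w N j)"
      by (intro dvd_sum) simp
    thus ?case by (simp add: algebra_simps sum_distrib_left sum_subtractf)
  qed
qed

section \<open>Finite forms of the product formulas for theta series\<close>

lemma prod_lessThan_add:
  fixes f :: "nat \<Rightarrow> 'a::comm_monoid_mult"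
  shows "(\<Prod>i<m + n. f i) = (\<Prod>i<m. f i) * (\<Prod>i<n. f (m + i))"
  by (induction n) (simp_all add: mult.assoc)

lemma prod_lessThan_double:
  fixes f :: "nat \<Rightarrow> 'a::comm_monoid_mult"
  shows "(\<Prod>i<2 * n. f i) = (\<Prod>i<n. f (2 * i)) * (\<Prod>i<n. f (2 * i + 1))"
  by (induction n) (simp_all add: mult_ac)

lemma two_choose_two: "2 * (j choose 2) + j = j * j"
  by (induction j) (simp_all add: numeral_2_eq_2)

lemma prod_powers: "(\<Prod>i<n. (p::'a::comm_monoid_mult) ^ i) = p ^ (n choose 2)"
  by (induction n) (simp_all add: numeral_2_eq_2 power_add mult.commute)

text \<open>
  The \<open>q\<close>-binomial theorem with \<open>p = q\<^sup>2\<close>, \<open>x = q\<close>, \<open>y = q\<^sup>2\<^sup>N\<close>. The first \<open>N\<close> factors,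
  reversed, and the last \<open>N\<close> factors are both powers of \<open>q\<close> times the product on the left.
  In the sum the square is completed, and the common factor with exponent \<open>3 N\<^sup>2\<close> cancels.
\<close>
lemma theta_product_eq_qbinom_sum:
  fixes q :: "'a::idom"
  assumes "q \<noteq> 0"
  shows "(\<Prod>i<N. 1 + q ^ (2 * i + 1)) ^ 2 =
    (\<Sum>j\<le>2 * N. qbinom (q ^ 2) (2 * N) j * q ^ nat ((int j - int N) ^ 2))"
proof -
  let ?P = "\<Prod>i<N. 1 + q ^ (2 * i + 1)"
  let ?f = "\<lambda>i. q ^ (2 * N) + q * (q ^ 2) ^ i"
  have "(\<Prod>i<N. ?f i) = (\<Prod>i<N. ?f (N - Suc i))"
    by (rule prod.nat_diff_reindex [symmetric])
  also have "\<dots> = (\<Prod>i<N. q * (q ^ 2) ^ (N - Suc i) * (1 + q ^ (2 * i + 1)))"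
  proof (intro prod.cong refl)
    fix i assume "i \<in> {..<N}"
    hence "2 * N = 1 + 2 * (N - Suc i) + (2 * i + 1)" by auto
    hence "q ^ (2 * N) = q * (q ^ 2) ^ (N - Suc i) * q ^ (2 * i + 1)"
      by (metis power_add power_mult power_one_right)
    thus "?f (N - Suc i) = q * (q ^ 2) ^ (N - Suc i) * (1 + q ^ (2 * i + 1))"
      by (simp only: distrib_left mult_1_right add.commute)
  qed
  also have "\<dots> = (\<Prod>i<N. q * (q ^ 2) ^ (N - Suc i)) * ?P" by (rule prod.distrib)
  also have "(\<Prod>i<N. q * (q ^ 2) ^ (N - Suc i)) = (\<Prod>i<N. q * (q ^ 2) ^ i)"
    by (rule prod.nat_diff_reindex)
  also have "\<dots> = q ^ (N * N)"
    by (simp add: prod.distrib prod_powers two_choose_two[symmetric] power_add power_mult mult.commute)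
  finally have 1: "(\<Prod>i<N. ?f i) = q ^ (N * N) * ?P" .
  have "(\<Prod>i<N. ?f (N + i)) = (\<Prod>i<N. q ^ (2 * N) * (1 + q ^ (2 * i + 1)))"
    by (intro prod.cong) (simp_all add: distrib_left power_add mult_ac flip: power_mult)
  hence 2: "(\<Prod>i<N. ?f (N + i)) = q ^ (2 * N * N) * ?P"
    by (simp add: prod.distrib power_mult)
  have "q ^ (3 * N * N) * ?P ^ 2 = (\<Prod>i<N + N. ?f i)"
    unfolding prod_lessThan_add 1 2
    by (simp add: power2_eq_square algebra_simps flip: power_add)
  also have "\<dots> = (\<Sum>j\<le>2 * N. qbinom (q ^ 2) (2 * N) j * (q ^ 2) ^ (j choose 2) * q ^ j
                      * (q ^ (2 * N)) ^ (2 * N - j))"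
    by (simp only: qbinomial_theorem flip: mult_2)
  also have "\<dots> = (\<Sum>j\<le>2 * N. q ^ (3 * N * N) *
                      (qbinom (q ^ 2) (2 * N) j * q ^ nat ((int j - int N) ^ 2)))"
  proof (intro sum.cong refl)
    fix j assume "j \<in> {..2 * N}"
    hence j: "j \<le> 2 * N" by simp
    have "int (2 * (j choose 2) + j + 2 * N * (2 * N - j)) = int j * int j + 2 * int N * (2 * int N - int j)"
      using j by (simp add: two_choose_two of_nat_diff)
    also have "\<dots> = int (3 * N * N) + (int j - int N) ^ 2"
      by (simp add: power2_eq_square algebra_simps)
    also have "\<dots> = int (3 * N * N + nat ((int j - int N) ^ 2))" by simp
    finally have "2 * (j choose 2) + j + 2 * N * (2 * N - j) = 3 * N * N + nat ((int j - int N) ^ 2)"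
      by (simp only: of_nat_eq_iff)
    hence "q ^ (2 * (j choose 2) + j + 2 * N * (2 * N - j)) = q ^ (3 * N * N + nat ((int j - int N) ^ 2))"
      by (rule arg_cong)
    hence "(q ^ 2) ^ (j choose 2) * q ^ j * (q ^ (2 * N)) ^ (2 * N - j) =
        q ^ (3 * N * N) * q ^ nat ((int j - int N) ^ 2)"
      by (simp only: power_add power_mult)
    thus "qbinom (q ^ 2) (2 * N) j * (q ^ 2) ^ (j choose 2) * q ^ j * (q ^ (2 * N)) ^ (2 * N - j) =
        q ^ (3 * N * N) * (qbinom (q ^ 2) (2 * N) j * q ^ nat ((int j - int N) ^ 2))"
      by (simp add: mult.assoc mult.left_commute)
  qed
  also have "\<dots> = q ^ (3 * N * N) * (\<Sum>j\<le>2 * N. qbinom (q ^ 2) (2 * N) j * q ^ nat ((int j - int N) ^ 2))"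
    by (rule sum_distrib_left [symmetric])
  finally show ?thesis using assms by simp
qed

text \<open>
  The \<open>q\<close>-binomial theorem with \<open>p = q\<^sup>2\<close>, \<open>x = 1\<close>, \<open>y = q\<^sup>2\<^sup>N\<close> and \<open>2 N + 1\<close> factors. The first
  \<open>N\<close> and the last \<open>N\<close> factors each give the product on the left; the middle one is
  \<open>q\<^sup>2\<^sup>N + q\<^sup>2\<^sup>N\<close> and contributes the \<open>2\<close>.
\<close>
lemma psi_product_eq_qbinom_sum:
  fixes q :: "'a::idom"
  assumes "q \<noteq> 0"
  shows "2 * (\<Prod>i<N. 1 + (q ^ 2) ^ Suc i) ^ 2 =
    (\<Sum>j\<le>2 * N + 1. qbinom (q ^ 2) (2 * N + 1) j * q ^ nat ((int j - int N) * (int j - int N - 1)))"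
proof -
  let ?P = "\<Prod>i<N. 1 + (q ^ 2) ^ Suc i"
  let ?f = "\<lambda>i. q ^ (2 * N) + 1 * (q ^ 2) ^ i"
  let ?C = "2 * (N choose 2) + 2 * N * Suc N"
  have "(\<Prod>i<N. ?f i) = (\<Prod>i<N. ?f (N - Suc i))"
    by (rule prod.nat_diff_reindex [symmetric])
  also have "\<dots> = (\<Prod>i<N. (q ^ 2) ^ (N - Suc i) * (1 + (q ^ 2) ^ Suc i))"
  proof (intro prod.cong refl)
    fix i assume "i \<in> {..<N}"
    hence "N = (N - Suc i) + Suc i" by auto
    hence "q ^ (2 * N) = (q ^ 2) ^ (N - Suc i) * (q ^ 2) ^ Suc i"
      by (metis power_add power_mult)
    thus "?f (N - Suc i) = (q ^ 2) ^ (N - Suc i) * (1 + (q ^ 2) ^ Suc i)"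
      by (simp only: distrib_left mult_1_right mult_1_left add.commute)
  qed
  also have "\<dots> = (\<Prod>i<N. (q ^ 2) ^ (N - Suc i)) * ?P" by (rule prod.distrib)
  also have "(\<Prod>i<N. (q ^ 2) ^ (N - Suc i)) = (\<Prod>i<N. (q ^ 2) ^ i)"
    by (rule prod.nat_diff_reindex)
  finally have 1: "(\<Prod>i<N. ?f i) = q ^ (2 * (N choose 2)) * ?P"
    by (simp only: prod_powers power_mult)
  have "(\<Prod>i<Suc N. ?f (N + i)) = (\<Prod>i<Suc N. q ^ (2 * N) * (1 + (q ^ 2) ^ i))"
    by (intro prod.cong) (simp_all add: distrib_left power_add mult_ac flip: power_mult)
  also have "\<dots> = q ^ (2 * N * Suc N) * (\<Prod>i<Suc N. 1 + (q ^ 2) ^ i)"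
    by (simp only: prod.distrib prod_constant card_lessThan power_mult)
  also have "(\<Prod>i<Suc N. 1 + (q ^ 2) ^ i) = 2 * ?P"
    by (subst prod.lessThan_Suc_shift) simp
  finally have 2: "(\<Prod>i<Suc N. ?f (N + i)) = q ^ (2 * N * Suc N) * (2 * ?P)" .
  have "q ^ ?C * (2 * ?P ^ 2) = (\<Prod>i<N + Suc N. ?f i)"
    unfolding prod_lessThan_add 1 2 by (simp only: power_add power2_eq_square mult_ac)
  also have "\<dots> = (\<Prod>i<2 * N + 1. ?f i)" by (simp only: mult_2) simp
  also have "\<dots> = (\<Sum>j\<le>2 * N + 1. qbinom (q ^ 2) (2 * N + 1) j * (q ^ 2) ^ (j choose 2) * 1 ^ j
                      * (q ^ (2 * N)) ^ (2 * N + 1 - j))"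
    by (rule qbinomial_theorem)
  also have "\<dots> = (\<Sum>j\<le>2 * N + 1. q ^ ?C * (qbinom (q ^ 2) (2 * N + 1) j
                      * q ^ nat ((int j - int N) * (int j - int N - 1))))"
  proof (intro sum.cong refl)
    fix j assume "j \<in> {..2 * N + 1}"
    hence j: "j \<le> 2 * N + 1" by simp
    let ?d = "int j - int N"
    have "?d * (?d - 1) \<ge> 0"
      by (cases "?d \<ge> 1") (auto intro: mult_nonpos_nonpos)
    moreover have ch: "2 * int (n choose 2) = int n * int n - int n" for n
      using two_choose_two[of n] by (metis add_diff_cancel_right' of_nat_add of_nat_mult of_nat_numeral)
    moreover have "int (2 * N * (2 * N + 1 - j)) = 2 * int N * (2 * int N + 1 - int j)"
      using j by (simp add: of_nat_diff)
    ultimately have "int (2 * (j choose 2) + 2 * N * (2 * N + 1 - j)) = int (?C + nat (?d * (?d - 1)))"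
      by (simp add: algebra_simps)
    hence "2 * (j choose 2) + 2 * N * (2 * N + 1 - j) = ?C + nat (?d * (?d - 1))"
      by (simp only: of_nat_eq_iff)
    hence "q ^ (2 * (j choose 2) + 2 * N * (2 * N + 1 - j)) = q ^ (?C + nat (?d * (?d - 1)))"
      by (rule arg_cong)
    hence "(q ^ 2) ^ (j choose 2) * (q ^ (2 * N)) ^ (2 * N + 1 - j) =
        q ^ ?C * q ^ nat (?d * (?d - 1))"
      by (simp only: power_add power_mult)
    hence "qbinom (q ^ 2) (2 * N + 1) j * ((q ^ 2) ^ (j choose 2) * (q ^ (2 * N)) ^ (2 * N + 1 - j)) =
        q ^ ?C * (qbinom (q ^ 2) (2 * N + 1) j * q ^ nat (?d * (?d - 1)))"
      by (simp only: mult.left_commute[of "qbinom _ _ _" "q ^ ?C"])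
    thus "qbinom (q ^ 2) (2 * N + 1) j * (q ^ 2) ^ (j choose 2) * 1 ^ j * (q ^ (2 * N)) ^ (2 * N + 1 - j) =
        q ^ ?C * (qbinom (q ^ 2) (2 * N + 1) j * q ^ nat (?d * (?d - 1)))"
      by (simp only: mult.assoc power_one mult_1_left)
  qed
  also have "\<dots> = q ^ ?C * (\<Sum>j\<le>2 * N + 1. qbinom (q ^ 2) (2 * N + 1) j
                      * q ^ nat ((int j - int N) * (int j - int N - 1)))"
    by (rule sum_distrib_left [symmetric])
  finally show ?thesis using assms by simp
qed

section \<open>Theta series and their dissection\<close>

lemma qpoch_double:
  "qpoch q (2 * N) = (\<Prod>i<N. 1 - q ^ (2 * i + 1)) * qpoch (q ^ 2) N"
proof -
  have "q ^ Suc (2 * i + 1) = (q ^ 2) ^ Suc i" for i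
    by (simp only: power_mult[symmetric]) simp
  thus ?thesis
    unfolding qpoch_def by (subst prod_lessThan_double) (simp add: mult.commute)
qed

lemma qpoch_square:
  "qpoch (q ^ 2) N = (\<Prod>i<N. 1 + q ^ Suc i) * qpoch q N"
proof -
  have "1 - (q ^ 2) ^ Suc i = (1 + q ^ Suc i) * (1 - q ^ Suc i)" for i
  proof -
    have "(q ^ 2) ^ Suc i = (q ^ Suc i) ^ 2" by (simp only: power_mult[symmetric] mult.commute)
    thus ?thesis by (simp add: power2_eq_square algebra_simps)
  qed
  thus ?thesis unfolding qpoch_def by (simp only: prod.distrib)
qed

lemma qpoch_double_tendsto:
  assumes "fps_nth q 0 = 0" "q \<noteq> 0"
  shows "(\<lambda>N. qpoch q (2 * N)) \<longlonglongrightarrow> euler_prod q"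
  by (rule filterlim_compose[OF qpoch_tendsto[OF assms]])
     (auto intro!: filterlim_subseq simp: strict_mono_def)

text \<open>
  Passing from \<open>q\<close> to \<open>- q\<close> changes only the factors with odd exponents, and
  \<open>(1 - q\<^sup>m) (1 + q\<^sup>m) = 1 - q\<^sup>2\<^sup>m\<close> turns these into odd factors in \<open>q\<^sup>2\<close>.
\<close>
lemma euler_prod_uminus_mult:
  assumes q: "fps_nth q 0 = 0" "q \<noteq> 0"
  shows "euler_prod q * euler_prod (- q) * euler_prod (q ^ 4) = euler_prod (q ^ 2) ^ 3"
proof (rule LIMSEQ_unique)
  show "(\<lambda>N. qpoch q (2 * N) * qpoch (- q) (2 * N) * qpoch (q ^ 4) N)
          \<longlonglongrightarrow> euler_prod q * euler_prod (- q) * euler_prod (q ^ 4)"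
    using q by (intro tendsto_mult qpoch_double_tendsto qpoch_tendsto)
               (simp_all add: fps_power_zeroth)
  have "qpoch q (2 * N) * qpoch (- q) (2 * N) * qpoch (q ^ 4) N
      = qpoch (q ^ 2) (2 * N) * qpoch (q ^ 2) N ^ 2" for N
  proof -
    have "(1 - q ^ (2 * i + 1)) * (1 - (- q) ^ (2 * i + 1)) = 1 - (q ^ 2) ^ (2 * i + 1)" for i
    proof -
      have "(q ^ 2) ^ (2 * i + 1) = q ^ (2 * i + 1) * q ^ (2 * i + 1)"
        by (simp only: power_mult[symmetric] power_add[symmetric]) simp
      thus ?thesis by (simp add: algebra_simps)
    qed
    hence "(\<Prod>i<N. 1 - q ^ (2 * i + 1)) * (\<Prod>i<N. 1 - (- q) ^ (2 * i + 1))
        = (\<Prod>i<N. 1 - (q ^ 2) ^ (2 * i + 1))"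
      by (simp only: prod.distrib[symmetric])
    moreover have "(q ^ 2) ^ 2 = q ^ 4" by (simp flip: power_mult)
    ultimately show ?thesis
      using qpoch_double[of "q ^ 2" N] unfolding qpoch_double[of q] qpoch_double[of "- q"]
      by (simp add: power2_eq_square mult_ac)
  qed
  thus "(\<lambda>N. qpoch q (2 * N) * qpoch (- q) (2 * N) * qpoch (q ^ 4) N)
          \<longlonglongrightarrow> euler_prod (q ^ 2) ^ 3"
    using q by (simp only: power3_eq_cube power2_eq_square mult.assoc[symmetric])
       (intro tendsto_mult qpoch_double_tendsto qpoch_tendsto; simp add: fps_power_zeroth)
qed

lemma fps_X_power_dvd_power:
  fixes q :: "'a::comm_ring_1 fps"
  assumes "fps_nth q 0 = 0" "K \<le> n"
  shows "fps_X ^ K dvd q ^ n"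
proof -
  have "fps_X dvd q" using fps_X_power_dvd_iff[of 1 q] assms by simp
  thus ?thesis using assms(2) by (meson dvd_power_same dvd_trans le_imp_power_dvd)
qed

lemma qbinom_power_sum_tendsto:
  assumes q: "fps_nth q 0 = 0" "q \<noteq> 0"
  assumes e: "\<And>N j K. N + K < j \<or> j + K \<le> N \<Longrightarrow> K \<le> e N j"
  assumes L: "(\<lambda>N. \<Sum>j\<le>2 * N + c. qbinom (q ^ 2) (2 * N + c) j * q ^ e N j) \<longlonglongrightarrow> L"
  shows "(\<lambda>N. \<Sum>j\<le>2 * N + c. q ^ e N j) \<longlonglongrightarrow> euler_prod (q ^ 2) * L"
proof -
  have "(\<lambda>N. euler_prod (q ^ 2) * (\<Sum>j\<le>2 * N + c. qbinom (q ^ 2) (2 * N + c) j * q ^ e N j)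
              - (\<Sum>j\<le>2 * N + c. q ^ e N j)) \<longlonglongrightarrow> 0"
    by (intro qbinom_sum_diff_tendsto_0 fps_X_power_dvd_power e) (use q in \<open>auto simp: fps_power_zeroth\<close>)
  from tendsto_diff[OF tendsto_mult[OF tendsto_const[of "euler_prod (q ^ 2)"] L] this] show ?thesis by simp
qed

text \<open>
  Gauss's product formula for \<open>\<phi>(q)\<close>, the sum of \<open>q ^ (k\<^sup>2)\<close> over all integers \<open>k\<close>:
  the product of \<open>1 + q\<^sup>m\<close> over odd \<open>m\<close> is \<open>euler_prod (- q) / euler_prod (q\<^sup>2)\<close>.
\<close>
lemma theta_tendsto:
  assumes q: "fps_nth q 0 = 0" "q \<noteq> 0"
  shows "(\<lambda>N. \<Sum>k=-int N..int N. q ^ nat (k ^ 2))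
           \<longlonglongrightarrow> euler_prod (- q) ^ 2 * inverse (euler_prod (q ^ 2))"
proof -
  let ?E = "euler_prod (q ^ 2)"
  have q2: "fps_nth (q ^ 2) 0 = 0" "q ^ 2 \<noteq> 0" using q by (simp_all add: fps_power_zeroth)
  note E0 = euler_prod_nth_0[OF q2]
  have "(\<lambda>N. qpoch (- q) (2 * N) * inverse (qpoch (q ^ 2) N)) \<longlonglongrightarrow> euler_prod (- q) * inverse ?E"
    by (intro tendsto_mult qpoch_double_tendsto tendsto_inverse_fps qpoch_tendsto)
       (use q q2 E0 in simp_all)
  moreover have "qpoch (- q) (2 * N) * inverse (qpoch (q ^ 2) N) = (\<Prod>i<N. 1 + q ^ (2 * i + 1))" for N
  proof -
    have "qpoch (q ^ 2) N * inverse (qpoch (q ^ 2) N) = 1"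
      using q2 by (intro inverse_mult_eq_1') simp
    thus ?thesis using qpoch_double[of "- q" N] by (simp add: mult.assoc)
  qed
  ultimately have "(\<lambda>N. (\<Prod>i<N. 1 + q ^ (2 * i + 1)) ^ 2) \<longlonglongrightarrow> (euler_prod (- q) * inverse ?E) ^ 2"
    by (simp only: power2_eq_square) (intro tendsto_mult; assumption)
  hence "(\<lambda>N. \<Sum>j\<le>2 * N + 0. qbinom (q ^ 2) (2 * N + 0) j * q ^ nat ((int j - int N) ^ 2))
      \<longlonglongrightarrow> (euler_prod (- q) * inverse ?E) ^ 2"
    by (simp only: theta_product_eq_qbinom_sum[OF q(2)] add_0_right)
  hence "(\<lambda>N. \<Sum>j\<le>2 * N + 0. q ^ nat ((int j - int N) ^ 2))
      \<longlonglongrightarrow> ?E * (euler_prod (- q) * inverse ?E) ^ 2"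
  proof (intro qbinom_power_sum_tendsto q)
    fix N j K :: nat assume "N + K < j \<or> j + K \<le> N"
    hence "int K \<le> \<bar>int j - int N\<bar>" by auto
    also have "\<dots> \<le> \<bar>int j - int N\<bar> ^ 2" using self_le_power[of "\<bar>int j - int N\<bar>" 2] by (cases "int j = int N") auto
    finally show "K \<le> nat ((int j - int N) ^ 2)" by simp
  qed
  moreover have "(\<Sum>j\<le>2 * N + 0. q ^ nat ((int j - int N) ^ 2)) = (\<Sum>k=-int N..int N. q ^ nat (k ^ 2))" for N
    by (rule sum.reindex_bij_witness[of _ "\<lambda>k. nat (k + int N)" "\<lambda>j. int j - int N"]) auto
  moreover have "?E * (euler_prod (- q) * inverse ?E) ^ 2 = euler_prod (- q) ^ 2 * inverse ?E * (?E * inverse ?E)"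
    by (simp add: power2_eq_square mult_ac)
  moreover have "?E * inverse ?E = 1" using E0 by (intro inverse_mult_eq_1') simp
  ultimately show ?thesis by simp
qed

text \<open>
  Gauss's product formula for \<open>\<psi>(q\<^sup>2)\<close>. Summing over all integers counts each exponent
  \<open>k (k - 1)\<close> twice, at \<open>k\<close> and \<open>1 - k\<close>.
\<close>
lemma psi_tendsto:
  assumes q: "fps_nth q 0 = 0" "q \<noteq> 0"
  shows "(\<lambda>N. \<Sum>k=-int N..int N + 1. q ^ nat (k * (k - 1)))
           \<longlonglongrightarrow> 2 * euler_prod (q ^ 4) ^ 2 * inverse (euler_prod (q ^ 2))"
proof -
  let ?E = "euler_prod (q ^ 2)" and ?E4 = "euler_prod (q ^ 4)"
  have q2: "fps_nth (q ^ 2) 0 = 0" "q ^ 2 \<noteq> 0" using q by (simp_all add: fps_power_zeroth)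
  have q4: "fps_nth (q ^ 4) 0 = 0" "q ^ 4 \<noteq> 0" using q by (simp_all add: fps_power_zeroth)
  have q22: "(q ^ 2) ^ 2 = q ^ 4" by (simp flip: power_mult)
  note E0 = euler_prod_nth_0[OF q2]
  have "(\<lambda>N. qpoch (q ^ 4) N * inverse (qpoch (q ^ 2) N)) \<longlonglongrightarrow> ?E4 * inverse ?E"
    by (intro tendsto_mult tendsto_inverse_fps qpoch_tendsto)
       (use q2 q4 E0 in simp_all)
  moreover have "qpoch (q ^ 4) N * inverse (qpoch (q ^ 2) N) = (\<Prod>i<N. 1 + (q ^ 2) ^ Suc i)" for N
  proof -
    have "qpoch (q ^ 2) N * inverse (qpoch (q ^ 2) N) = 1"
      using q2 by (intro inverse_mult_eq_1') simp
    thus ?thesis using qpoch_square[of "q ^ 2" N] unfolding q22 by (simp only: mult.assoc) simp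
  qed
  ultimately have "(\<lambda>N. 2 * (\<Prod>i<N. 1 + (q ^ 2) ^ Suc i) ^ 2) \<longlonglongrightarrow> 2 * (?E4 * inverse ?E) ^ 2"
    by (simp only: power2_eq_square) (intro tendsto_mult tendsto_const; assumption)
  hence "(\<lambda>N. \<Sum>j\<le>2 * N + 1. qbinom (q ^ 2) (2 * N + 1) j * q ^ nat ((int j - int N) * (int j - int N - 1)))
      \<longlonglongrightarrow> 2 * (?E4 * inverse ?E) ^ 2"
    by (simp only: psi_product_eq_qbinom_sum[OF q(2)])
  hence "(\<lambda>N. \<Sum>j\<le>2 * N + 1. q ^ nat ((int j - int N) * (int j - int N - 1)))
      \<longlonglongrightarrow> ?E * (2 * (?E4 * inverse ?E) ^ 2)"
  proof (intro qbinom_power_sum_tendsto q)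
    fix N j K :: nat assume *: "N + K < j \<or> j + K \<le> N"
    define d where "d = int j - int N"
    from * have "int K \<le> d - 1 \<or> int K \<le> - d" by (auto simp: d_def)
    hence "int K \<le> d * (d - 1)"
    proof
      assume "int K \<le> d - 1"
      moreover from this have "1 * (d - 1) \<le> d * (d - 1)" by (intro mult_right_mono) auto
      ultimately show ?thesis by simp
    next
      assume "int K \<le> - d"
      moreover have "d * (d - 1) = d * d + (- d)" by (simp add: algebra_simps)
      ultimately show ?thesis using zero_le_square[of d] by linarith
    qed
    thus "K \<le> nat ((int j - int N) * (int j - int N - 1))" by (simp add: d_def)
  qed
  moreover have "(\<Sum>j\<le>2 * N + 1. q ^ nat ((int j - int N) * (int j - int N - 1)))
      = (\<Sum>k=-int N..int N + 1. q ^ nat (k * (k - 1)))" for N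
    by (rule sum.reindex_bij_witness[of _ "\<lambda>k. nat (k + int N)" "\<lambda>j. int j - int N"]) auto
  moreover have "?E * (2 * (?E4 * inverse ?E) ^ 2) = 2 * ?E4 ^ 2 * inverse ?E * (?E * inverse ?E)"
    by (simp add: power2_eq_square mult_ac)
  moreover have "?E * inverse ?E = 1" using E0 by (intro inverse_mult_eq_1') simp
  ultimately show ?thesis by simp
qed

text \<open>
  Even \<open>k = 2 m\<close> contribute the exponents \<open>4 m\<^sup>2\<close>, odd \<open>k = 2 m - 1\<close> the exponents
  \<open>4 m (m - 1) + 1\<close>. The range up to \<open>2 N + 1\<close> makes this exact for the partial sums.
\<close>
lemma theta_partial_sum_dissection:
  fixes q :: "'a::comm_ring_1"
  shows "(\<Sum>k=-int (2 * N + 1)..int (2 * N + 1). q ^ nat (k ^ 2)) =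
    (\<Sum>k=-int N..int N. (q ^ 4) ^ nat (k ^ 2)) + q * (\<Sum>k=-int N..int N + 1. (q ^ 4) ^ nat (k * (k - 1)))"
proof -
  let ?A = "{-int (2 * N + 1)..int (2 * N + 1)}"
  have fin: "finite {k\<in>?A. P k}" for P
    by (rule finite_subset[of _ ?A]) auto
  have "(\<Sum>k\<in>?A. q ^ nat (k ^ 2)) = (\<Sum>k\<in>{k\<in>?A. even k} \<union> {k\<in>?A. odd k}. q ^ nat (k ^ 2))"
    by (rule sum.cong) auto
  also have "\<dots> = (\<Sum>k\<in>{k\<in>?A. even k}. q ^ nat (k ^ 2)) + (\<Sum>k\<in>{k\<in>?A. odd k}. q ^ nat (k ^ 2))"
    by (rule sum.union_disjoint[OF fin fin]) auto
  also have "(\<Sum>k\<in>{k\<in>?A. even k}. q ^ nat (k ^ 2)) = (\<Sum>k=-int N..int N. q ^ nat ((2 * k) ^ 2))"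
    by (rule sum.reindex_bij_witness[of _ "\<lambda>k. 2 * k" "\<lambda>k. k div 2"]) auto
  also have "\<dots> = (\<Sum>k=-int N..int N. (q ^ 4) ^ nat (k ^ 2))"
    by (simp add: power_mult_distrib nat_mult_distrib power_mult)
  also have "(\<Sum>k\<in>{k\<in>?A. odd k}. q ^ nat (k ^ 2)) = (\<Sum>k=-int N..int N + 1. q ^ nat ((2 * k - 1) ^ 2))"
    by (rule sum.reindex_bij_witness[of _ "\<lambda>k. 2 * k - 1" "\<lambda>k. (k + 1) div 2"]) (auto elim!: oddE simp: add.commute)
  also have "\<dots> = (\<Sum>k=-int N..int N + 1. q * (q ^ 4) ^ nat (k * (k - 1)))"
  proof (intro sum.cong refl)
    fix k :: int
    have "k * (k - 1) \<ge> 0" by (cases "k \<ge> 1") (auto intro: mult_nonpos_nonpos)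
    moreover have "(2 * k - 1) ^ 2 = 4 * (k * (k - 1)) + 1" by (simp add: power2_eq_square algebra_simps)
    ultimately have "nat ((2 * k - 1) ^ 2) = 4 * nat (k * (k - 1)) + 1"
      by (simp add: nat_add_distrib nat_mult_distrib)
    thus "q ^ nat ((2 * k - 1) ^ 2) = q * (q ^ 4) ^ nat (k * (k - 1))"
      by (simp add: power_add power_mult)
  qed
  finally show ?thesis by (simp only: sum_distrib_left)
qed

text \<open>
  The classical \<open>\<phi>(q) = \<phi>(q\<^sup>4) + 2 q \<psi>(q\<^sup>8)\<close>, with every theta series written as a product. It
  is needed for arbitrary \<open>q\<close> without constant term, because it will be applied not only to
  \<open>X\<close> and \<open>- X\<close> but also to \<open>i X\<close> and \<open>- i X\<close>.
\<close>
lemma theta_dissection: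
  assumes q: "fps_nth q 0 = 0" "q \<noteq> 0"
  shows "euler_prod (- q) ^ 2 * inverse (euler_prod (q ^ 2)) =
     (euler_prod (- (q ^ 4)) ^ 2 + 2 * q * euler_prod (q ^ 16) ^ 2) * inverse (euler_prod (q ^ 8))"
proof (rule LIMSEQ_unique)
  have q4: "fps_nth (q ^ 4) 0 = 0" "q ^ 4 \<noteq> 0" using q by (simp_all add: fps_power_zeroth)
  have pw: "(q ^ 4) ^ 2 = q ^ 8" "(q ^ 4) ^ 4 = q ^ 16" by (simp_all flip: power_mult)
  have "(\<lambda>N. \<Sum>k=-int (2 * N + 1)..int (2 * N + 1). q ^ nat (k ^ 2))
          \<longlonglongrightarrow> euler_prod (- q) ^ 2 * inverse (euler_prod (q ^ 2))"
    by (rule filterlim_compose[OF theta_tendsto[OF q]])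
       (auto intro!: filterlim_subseq simp: strict_mono_def)
  thus "(\<lambda>N. (\<Sum>k=-int N..int N. (q ^ 4) ^ nat (k ^ 2))
            + q * (\<Sum>k=-int N..int N + 1. (q ^ 4) ^ nat (k * (k - 1))))
          \<longlonglongrightarrow> euler_prod (- q) ^ 2 * inverse (euler_prod (q ^ 2))"
    by (simp only: theta_partial_sum_dissection)
  show "(\<lambda>N. (\<Sum>k=-int N..int N. (q ^ 4) ^ nat (k ^ 2))
            + q * (\<Sum>k=-int N..int N + 1. (q ^ 4) ^ nat (k * (k - 1))))
          \<longlonglongrightarrow> (euler_prod (- (q ^ 4)) ^ 2 + 2 * q * euler_prod (q ^ 16) ^ 2) * inverse (euler_prod (q ^ 8))"
    using tendsto_add[OF theta_tendsto[OF q4] tendsto_mult[OF tendsto_const[of q] psi_tendsto[OF q4]]]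
    by (simp add: pw algebra_simps)
qed

section \<open>Eta quotients and the quartic relation\<close>

lemma prod_inverse_qpoch:
  "(\<Prod>n<N. inverse (1 - q ^ Suc n)) = inverse (qpoch q N)" for q :: "'a::field fps"
  by (induction N) (simp_all add: qpoch_def fps_inverse_mult)

lemma tendsto_power_fps:
  fixes g :: "'a::comm_ring_1 fps"
  assumes "(f \<longlongrightarrow> g) F"
  shows "((\<lambda>x. f x ^ n) \<longlongrightarrow> g ^ n) F"
  by (induction n) (simp_all add: tendsto_mult assms)

text \<open>
  Two factors above and two below cover both eta quotients of the theorem; an exponent \<open>0\<close>
  drops a factor.
\<close>
lemma prodinf_eta_quotient:
  fixes q r s t :: "complex fps"
  assumes z: "fps_nth q 0 = 0" "fps_nth r 0 = 0" "fps_nth s 0 = 0" "fps_nth t 0 = 0"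
    and nz: "q \<noteq> 0" "r \<noteq> 0" "s \<noteq> 0" "t \<noteq> 0"
  shows "(\<Prod>n. ((1 - q ^ Suc n) ^ a * (1 - r ^ Suc n) ^ b) / ((1 - s ^ Suc n) ^ c * (1 - t ^ Suc n) ^ d))
      * (euler_prod s ^ c * euler_prod t ^ d) = euler_prod q ^ a * euler_prod r ^ b"
proof -
  let ?L = "euler_prod q ^ a * euler_prod r ^ b * (inverse (euler_prod s) ^ c * inverse (euler_prod t) ^ d)"
  note E0 = euler_prod_nth_0
  have "(\<Prod>n<N. ((1 - q ^ Suc n) ^ a * (1 - r ^ Suc n) ^ b) / ((1 - s ^ Suc n) ^ c * (1 - t ^ Suc n) ^ d))
      = qpoch q N ^ a * qpoch r N ^ b * (inverse (qpoch s N) ^ c * inverse (qpoch t N) ^ d)" for N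
  proof -
    have "((1 - q ^ Suc n) ^ a * (1 - r ^ Suc n) ^ b) / ((1 - s ^ Suc n) ^ c * (1 - t ^ Suc n) ^ d) =
      (1 - q ^ Suc n) ^ a * (1 - r ^ Suc n) ^ b * (inverse (1 - s ^ Suc n) ^ c * inverse (1 - t ^ Suc n) ^ d)" for n
      using z by (subst fps_divide_unit) (simp_all add: fps_power_zeroth fps_inverse_mult fps_inverse_power)
    thus ?thesis
      unfolding prod_inverse_qpoch[symmetric]
      by (simp only: prod.distrib prod_power_distrib qpoch_def)
  qed
  moreover have "(\<lambda>N. qpoch q N ^ a * qpoch r N ^ b * (inverse (qpoch s N) ^ c * inverse (qpoch t N) ^ d)) \<longlonglongrightarrow> ?L"
    using z nz by (intro tendsto_mult tendsto_power_fps tendsto_inverse_fps qpoch_tendsto) (simp_all add: E0)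
  moreover have "?L \<noteq> 0"
    using z nz E0[of q] E0[of r] E0[of s] E0[of t] by auto
  ultimately have "(\<Prod>n. ((1 - q ^ Suc n) ^ a * (1 - r ^ Suc n) ^ b) / ((1 - s ^ Suc n) ^ c * (1 - t ^ Suc n) ^ d)) = ?L"
    by (intro prodinf_eqI) simp_all
  moreover have "inverse (euler_prod s) * euler_prod s = 1" "inverse (euler_prod t) * euler_prod t = 1"
    using z nz by (auto intro!: inverse_mult_eq_1 simp: E0)
  hence "(inverse (euler_prod s) ^ c * inverse (euler_prod t) ^ d) * (euler_prod s ^ c * euler_prod t ^ d) = 1"
    by (metis (no_types, opaque_lifting) mult.assoc mult.commute power_mult_distrib power_one mult_1_right)
  ultimately show ?thesis by (simp only: mult.assoc mult_1_right)
qed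

lemma G2_eq: "G2 * euler_prod fps_X ^ 24 = fps_X * euler_prod (fps_X ^ 2) ^ 24"
proof -
  let ?X = "fps_X :: complex fps"
  have "((1 - ?X ^ (2 * Suc n)) / (1 - ?X ^ Suc n)) ^ 24 =
    ((1 - (?X ^ 2) ^ Suc n) ^ 24 * (1 - ?X ^ Suc n) ^ 0) / ((1 - ?X ^ Suc n) ^ 24 * (1 - ?X ^ Suc n) ^ 0)" for n
    by (subst (1 2) fps_divide_unit)
       (simp_all add: fps_power_zeroth fps_inverse_power power_mult_distrib power_mult del: power_Suc mult_Suc_right)
  hence *: "G2 = ?X * (\<Prod>n. ((1 - (?X ^ 2) ^ Suc n) ^ 24 * (1 - ?X ^ Suc n) ^ 0) / ((1 - ?X ^ Suc n) ^ 24 * (1 - ?X ^ Suc n) ^ 0))"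
    unfolding G2_def by (simp only:)
  show ?thesis
    unfolding * using prodinf_eta_quotient[of "?X ^ 2" ?X ?X ?X 24 0 24 0]
    by (simp only: power_0 mult_1_right mult.assoc) simp
qed

lemma G8_eq: "G8 * (euler_prod (fps_X ^ 4) ^ 2 * euler_prod fps_X ^ 4)
   = fps_X * (euler_prod (fps_X ^ 8) ^ 4 * euler_prod (fps_X ^ 2) ^ 2)"
  unfolding G8_def power_mult
  using prodinf_eta_quotient[of "fps_X ^ 8" "fps_X ^ 2" "fps_X ^ 4" fps_X 4 2 2 4] by (simp only: mult.assoc) simp

text \<open>
  The remaining algebra, where \<open>e\<^sub>k\<close> stands for \<open>euler_prod (X\<^sup>k)\<close>, \<open>f\<^sub>k\<close> for
  \<open>euler_prod (- X\<^sup>k)\<close>, the letters \<open>em\<close>, \<open>ei\<close>, \<open>emi\<close> for the values at \<open>- X\<close>, \<open>i X\<close>,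
  \<open>- i X\<close>, and where \<open>a = \<phi>(X\<^sup>4)\<close>, \<open>b = 2 X \<psi>(X\<^sup>8)\<close>. The relations say that \<open>\<phi>\<close> takes the
  values \<open>a + b\<close>, \<open>a - b\<close>, \<open>a + i b\<close>, \<open>a - i b\<close> at \<open>X\<close>, \<open>- X\<close>, \<open>i X\<close>, \<open>- i X\<close>. Hence
  \<open>a\<^sup>2 - b\<^sup>2\<close> and \<open>a\<^sup>2 + b\<^sup>2\<close> are products, and so is \<open>a b\<close>; in terms of these, both sides of
  the quartic relation become explicit.
\<close>
lemma eta_relations_imp_quartic:
  fixes x e\<^sub>1 em e\<^sub>2 e\<^sub>4 e\<^sub>8 e\<^sub>1\<^sub>6 f\<^sub>2 f\<^sub>4 ei emi i a b g8 g2 :: "'a::idom"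
  assumes nz: "e\<^sub>1 \<noteq> 0" "e\<^sub>2 \<noteq> 0" "e\<^sub>4 \<noteq> 0" "e\<^sub>8 \<noteq> 0" "f\<^sub>2 \<noteq> 0" "(2::'a) \<noteq> 0"
    and i: "i * i = -1"
    and a: "a * e\<^sub>8 = f\<^sub>4 ^ 2" and b: "b * e\<^sub>8 = 2 * x * e\<^sub>1\<^sub>6 ^ 2"
    and dm: "em ^ 2 = e\<^sub>2 * (a + b)" and d1: "e\<^sub>1 ^ 2 = e\<^sub>2 * (a - b)"
    and dmi: "emi ^ 2 = f\<^sub>2 * (a + i * b)" and di: "ei ^ 2 = f\<^sub>2 * (a - i * b)"
    and p1: "e\<^sub>1 * em * e\<^sub>4 = e\<^sub>2 ^ 3" and pi: "ei * emi * e\<^sub>4 = f\<^sub>2 ^ 3"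
    and p2: "e\<^sub>2 * f\<^sub>2 * e\<^sub>8 = e\<^sub>4 ^ 3" and p4: "e\<^sub>4 * f\<^sub>4 * e\<^sub>1\<^sub>6 = e\<^sub>8 ^ 3"
    and g8: "g8 * (e\<^sub>4 ^ 2 * e\<^sub>1 ^ 4) = x * (e\<^sub>8 ^ 4 * e\<^sub>2 ^ 2)"
    and g2: "g2 * e\<^sub>1 ^ 24 = x * e\<^sub>2 ^ 24"
  shows "g2 = g8 + 20 * g8 ^ 2 + 128 * g8 ^ 3 + 256 * g8 ^ 4"
proof -
  have ab: "a * b * e\<^sub>4 ^ 2 = 2 * x * e\<^sub>8 ^ 4"
  proof -
    have "e\<^sub>8 ^ 2 * (a * b * e\<^sub>4 ^ 2) = (a * e\<^sub>8) * (b * e\<^sub>8) * e\<^sub>4 ^ 2"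
      by (simp add: power2_eq_square mult_ac)
    also have "\<dots> = 2 * x * (e\<^sub>4 * f\<^sub>4 * e\<^sub>1\<^sub>6) ^ 2"
      unfolding a b by (simp add: power2_eq_square mult_ac)
    also have "\<dots> = e\<^sub>8 ^ 2 * (2 * x * e\<^sub>8 ^ 4)"
      unfolding p4 by (simp add: mult_ac flip: power_add power_mult)
    finally show ?thesis using nz unfolding mult_cancel_left by simp
  qed
  have minus: "(a ^ 2 - b ^ 2) * e\<^sub>4 ^ 2 = e\<^sub>2 ^ 4"
  proof -
    have "e\<^sub>2 ^ 2 * ((a ^ 2 - b ^ 2) * e\<^sub>4 ^ 2) = (e\<^sub>2 * (a - b)) * (e\<^sub>2 * (a + b)) * e\<^sub>4 ^ 2"
      by (simp add: power2_eq_square algebra_simps)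
    also have "\<dots> = (e\<^sub>1 * em * e\<^sub>4) ^ 2"
      by (simp only: d1[symmetric] dm[symmetric] power_mult_distrib)
    also have "\<dots> = e\<^sub>2 ^ 2 * e\<^sub>2 ^ 4" unfolding p1 by (simp flip: power_add power_mult)
    finally show ?thesis using nz unfolding mult_cancel_left by simp
  qed
  have "f\<^sub>2 ^ 4 = (a ^ 2 + b ^ 2) * e\<^sub>4 ^ 2"
  proof -
    have "(a - i * b) * (a + i * b) = a ^ 2 - (i * i) * b ^ 2"
      by (simp add: power2_eq_square algebra_simps)
    hence "f\<^sub>2 ^ 2 * ((a ^ 2 + b ^ 2) * e\<^sub>4 ^ 2) = (f\<^sub>2 * (a - i * b)) * (f\<^sub>2 * (a + i * b)) * e\<^sub>4 ^ 2"
      by (simp add: i power2_eq_square mult_ac)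
    also have "\<dots> = (ei * emi * e\<^sub>4) ^ 2"
      by (simp only: di[symmetric] dmi[symmetric] power_mult_distrib)
    also have "\<dots> = f\<^sub>2 ^ 2 * f\<^sub>2 ^ 4" unfolding pi by (simp flip: power_add power_mult)
    finally show ?thesis using nz unfolding mult_cancel_left by simp
  qed
  hence "e\<^sub>4 ^ 2 * ((a ^ 2 + b ^ 2) * e\<^sub>2 ^ 4 * e\<^sub>8 ^ 4) = (e\<^sub>2 * f\<^sub>2 * e\<^sub>8) ^ 4"
    by (simp add: power_mult_distrib mult_ac)
  also have "\<dots> = e\<^sub>4 ^ 2 * e\<^sub>4 ^ 10" unfolding p2 by (simp flip: power_add power_mult)
  finally have plus: "(a ^ 2 + b ^ 2) * e\<^sub>2 ^ 4 * e\<^sub>8 ^ 4 = e\<^sub>4 ^ 10" using nz unfolding mult_cancel_left by simp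

  \<comment> \<open>After substituting the three product formulas, the powers of \<open>e\<^sub>4\<close> and \<open>e\<^sub>8\<close> cancel.\<close>
  have key: "a * b * (a ^ 2 + b ^ 2) * (a ^ 2 - b ^ 2) ^ 4 = 2 * x * e\<^sub>2 ^ 12"
  proof -
    have "(e\<^sub>4 ^ 10 * e\<^sub>2 ^ 4 * e\<^sub>8 ^ 4) * (a * b * (a ^ 2 + b ^ 2) * (a ^ 2 - b ^ 2) ^ 4)
       = (a * b * e\<^sub>4 ^ 2) * ((a ^ 2 + b ^ 2) * e\<^sub>2 ^ 4 * e\<^sub>8 ^ 4) * ((a ^ 2 - b ^ 2) * e\<^sub>4 ^ 2) ^ 4"
    proof -
      have "e\<^sub>4 ^ 10 = e\<^sub>4 ^ 2 * (e\<^sub>4 ^ 2) ^ 4" by (simp flip: power_add power_mult)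
      thus ?thesis by (simp only: power_mult_distrib mult_ac)
    qed
    also have "\<dots> = (e\<^sub>4 ^ 10 * e\<^sub>2 ^ 4 * e\<^sub>8 ^ 4) * (2 * x * e\<^sub>2 ^ 12)"
      unfolding ab plus minus by (simp add: mult_ac flip: power_add power_mult)
    finally show ?thesis using nz unfolding mult_cancel_left by simp
  qed

  define d where "d = (a - b) ^ 2"
  have e1_4: "e\<^sub>1 ^ 4 = e\<^sub>2 ^ 2 * d"
  proof -
    have "e\<^sub>1 ^ 4 = (e\<^sub>1 ^ 2) ^ 2" by (simp flip: power_mult)
    thus ?thesis unfolding d1 d_def by (simp only: power_mult_distrib)
  qed
  have "d \<noteq> 0" using e1_4 nz by auto
  have "(e\<^sub>2 ^ 2 * e\<^sub>4 ^ 2) * (2 * g8 * d) = 2 * (g8 * (e\<^sub>4 ^ 2 * e\<^sub>1 ^ 4))"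
    unfolding e1_4 by (simp add: mult_ac)
  also have "\<dots> = e\<^sub>2 ^ 2 * (a * b * e\<^sub>4 ^ 2)" unfolding g8 ab by (simp add: mult_ac)
  also have "\<dots> = (e\<^sub>2 ^ 2 * e\<^sub>4 ^ 2) * (a * b)" by (simp add: mult_ac)
  finally have G8: "2 * g8 * d = a * b" using nz unfolding mult_cancel_left by simp
  have "e\<^sub>2 ^ 12 * (g2 * d ^ 6) = g2 * (e\<^sub>1 ^ 4) ^ 6"
    unfolding e1_4 by (simp add: power_mult_distrib mult_ac flip: power_mult)
  also have "\<dots> = e\<^sub>2 ^ 12 * (x * e\<^sub>2 ^ 12)"
    using g2 by (simp add: mult_ac flip: power_mult power_add)
  finally have G2: "g2 * d ^ 6 = x * e\<^sub>2 ^ 12" using nz unfolding mult_cancel_left by simp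
  \<comment> \<open>The quartic factors as \<open>g (1 + 4 g) (1 + 8 g)\<^sup>2\<close>, and \<open>2 g8 d = a b\<close> turns
    \<open>d + 4 g8 d\<close> into \<open>a\<^sup>2 + b\<^sup>2\<close> and \<open>d + 8 g8 d\<close> into \<open>(a + b)\<^sup>2\<close>.\<close>
  have "2 * d ^ 6 * (g8 + 20 * g8 ^ 2 + 128 * g8 ^ 3 + 256 * g8 ^ 4)
      = d ^ 2 * (2 * g8 * d) * (d + 2 * (2 * g8 * d)) * (d + 4 * (2 * g8 * d)) ^ 2"
    by algebra
  also have "\<dots> = d ^ 2 * (a * b) * (a ^ 2 + b ^ 2) * ((a + b) ^ 2) ^ 2"
  proof -
    have "d + 2 * (a * b) = a ^ 2 + b ^ 2" "d + 4 * (a * b) = (a + b) ^ 2"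
      unfolding d_def by (simp_all add: power2_eq_square algebra_simps)
    thus ?thesis unfolding G8 by simp
  qed
  also have "\<dots> = a * b * (a ^ 2 + b ^ 2) * (a ^ 2 - b ^ 2) ^ 4"
    unfolding d_def by algebra
  also have "\<dots> = 2 * d ^ 6 * g2" using key G2 by (simp add: mult_ac)
  finally show ?thesis using nz \<open>d \<noteq> 0\<close> by simp
qed

theorem lemma3p7: "G2 = G8 + 20 * G8 ^ 2 + 128 * G8 ^ 3 + 256 * G8 ^ 4"
proof -
  let ?X = "fps_X :: complex fps" and ?i = "fps_const \<i>"
  let ?a = "euler_prod (- (?X ^ 4)) ^ 2 * inverse (euler_prod (?X ^ 8))"
  let ?b = "2 * ?X * euler_prod (?X ^ 16) ^ 2 * inverse (euler_prod (?X ^ 8))"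
  have ii: "?i * ?i = -1" by (simp add: fps_const_mult)
  have i2: "?i ^ 2 = -1" using ii by (simp add: power2_eq_square)
  have i4: "?i ^ 4 = 1"
  proof -
    have "?i ^ 4 = (?i ^ 2) ^ 2" by (simp flip: power_mult)
    thus ?thesis unfolding i2 by simp
  qed
  have i8: "?i ^ 8 = 1" "?i ^ 16 = 1"
    using i4 power_mult[of ?i 4 2] power_mult[of ?i 4 4] by simp_all
  have iX: "(?i * ?X) ^ 2 = - (?X ^ 2)" "(?i * ?X) ^ 4 = ?X ^ 4" "(?i * ?X) ^ 8 = ?X ^ 8" "(?i * ?X) ^ 16 = ?X ^ 16"
    by (simp_all only: power_mult_distrib i2 i4 i8) simp_all
  have X0: "fps_nth ?X 0 = 0" "?X \<noteq> 0" "fps_nth (- ?X) 0 = 0" "- ?X \<noteq> 0"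
    "fps_nth (?i * ?X) 0 = 0" "?i * ?X \<noteq> 0" "fps_nth (- (?i * ?X)) 0 = 0" "- (?i * ?X) \<noteq> 0"
    by simp_all
  have unit: "fps_nth (euler_prod q) 0 = 1 \<Longrightarrow> euler_prod q \<noteq> 0" for q by auto
  have inv: "inverse (euler_prod (?X ^ 8)) * euler_prod (?X ^ 8) = 1"
    by (intro inverse_mult_eq_1) (simp add: euler_prod_nth_0)
  have div: "u = w * v" if "u * inverse w = v" "fps_nth w 0 = 1" for u v w :: "complex fps"
  proof -
    have "w * (u * inverse w) = u * (inverse w * w)" by (simp add: mult_ac)
    also have "inverse w * w = 1" using that by (intro inverse_mult_eq_1) simp
    finally show ?thesis using that by simp
  qed
  have 1: "euler_prod (?X ^ 2) \<noteq> 0" "euler_prod (?X ^ 4) \<noteq> 0" "euler_prod (?X ^ 8) \<noteq> 0"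
    "euler_prod ?X \<noteq> 0" "euler_prod (- (?X ^ 2)) \<noteq> 0"
    by (rule unit, rule euler_prod_nth_0; simp)+
  show ?thesis
  proof (rule eta_relations_imp_quartic[where x = ?X and a = ?a and b = ?b and i = ?i
        and e\<^sub>1 = "euler_prod ?X" and em = "euler_prod (- ?X)" and e\<^sub>2 = "euler_prod (?X ^ 2)"
        and e\<^sub>4 = "euler_prod (?X ^ 4)" and e\<^sub>8 = "euler_prod (?X ^ 8)" and e\<^sub>1\<^sub>6 = "euler_prod (?X ^ 16)"
        and f\<^sub>2 = "euler_prod (- (?X ^ 2))" and f\<^sub>4 = "euler_prod (- (?X ^ 4))"
        and ei = "euler_prod (?i * ?X)" and emi = "euler_prod (- (?i * ?X))", OF 1(4,1,2,3,5) _ ii])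
    show "?a * euler_prod (?X ^ 8) = euler_prod (- (?X ^ 4)) ^ 2"
      "?b * euler_prod (?X ^ 8) = 2 * ?X * euler_prod (?X ^ 16) ^ 2"
      by (simp_all add: mult.assoc inv)
    show "euler_prod (- ?X) ^ 2 = euler_prod (?X ^ 2) * (?a + ?b)"
      by (rule div) (use theta_dissection[OF X0(1,2)] in \<open>simp_all add: euler_prod_nth_0 distrib_right\<close>)
    show "euler_prod ?X ^ 2 = euler_prod (?X ^ 2) * (?a - ?b)"
      by (rule div) (use theta_dissection[OF X0(3,4)] in \<open>simp_all add: euler_prod_nth_0 algebra_simps\<close>)
    show "euler_prod (- (?i * ?X)) ^ 2 = euler_prod (- (?X ^ 2)) * (?a + ?i * ?b)"
      by (rule div) (use theta_dissection[OF X0(5,6), unfolded iX] in \<open>simp_all add: euler_prod_nth_0 algebra_simps\<close>)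
    have mi: "(- (?i * ?X)) ^ 2 = - (?X ^ 2)" "(- (?i * ?X)) ^ 4 = ?X ^ 4"
      "(- (?i * ?X)) ^ 8 = ?X ^ 8" "(- (?i * ?X)) ^ 16 = ?X ^ 16"
      using iX by simp_all
    show "euler_prod (?i * ?X) ^ 2 = euler_prod (- (?X ^ 2)) * (?a - ?i * ?b)"
      by (rule div) (use theta_dissection[OF X0(7,8), unfolded mi] in \<open>simp_all add: euler_prod_nth_0 algebra_simps\<close>)
    show "euler_prod ?X * euler_prod (- ?X) * euler_prod (?X ^ 4) = euler_prod (?X ^ 2) ^ 3"
      by (rule euler_prod_uminus_mult) simp_all
    show "euler_prod (?i * ?X) * euler_prod (- (?i * ?X)) * euler_prod (?X ^ 4) = euler_prod (- (?X ^ 2)) ^ 3"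
      using euler_prod_uminus_mult[OF X0(5,6), unfolded iX] .
    show "euler_prod (?X ^ 2) * euler_prod (- (?X ^ 2)) * euler_prod (?X ^ 8) = euler_prod (?X ^ 4) ^ 3"
      using euler_prod_uminus_mult[of "?X ^ 2"] by (simp flip: power_mult)
    show "euler_prod (?X ^ 4) * euler_prod (- (?X ^ 4)) * euler_prod (?X ^ 16) = euler_prod (?X ^ 8) ^ 3"
      using euler_prod_uminus_mult[of "?X ^ 4"] by (simp flip: power_mult)
  qed (use G2_eq G8_eq in simp_all)
qed

end
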